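(* Let $\mathcal{X}$ be a finite nonempty set of decisions and let $\mathcal{D}$ denote the set of probability distributions on $\mathcal{X}$. Consider (1) a ground set $U$ with a partition $\Gamma=\{U_1,\ldots,U_\gamma\}$ into nonempty groups and nonnegative set functions $f_x:\mathcal{P}(U)\to\mathbb{R}$ for $x\in\mathcal{X}$; and (2) a ground set $U'$ with a partition $\Gamma'=\{U'_1,\ldots,U'_{\gamma'}\}\subseteq\Gamma$ (so $U'=U'_1\sqcup\cdots\sqcup U'_{\gamma'}$ is a union of some of the groups of $\Gamma$) and superadditive set functions $f'_x:\mathcal{P}(U')\to\mathbb{R}$ for $x\in\mathcal{X}$. Let $\mathrm{DF\text{-}MV}=\max_{D\in\mathcal{D}}\min_{i\in[\gamma]}\mathbb{E}_{x\sim D} f_x(U_i)$ and $\mathrm{DF\text{-}MP}=\max_{D\in\mathcal{D}}\min_{i\in[\gamma]}\mathbb{E}_{x\sim D}\frac{f_x(U_i)}{|U_i|}$ for the first problem, and $\mathrm{MV}'=\max_{x\in\mathcal{X}} f'_x(U')$ and $\mathrm{MP}'=\max_{x\in\mathcal{X}}\frac{f'_x(U')}{|U'|}$ for the second. Let $\delta$ assign a real number $\delta(U'_i)$ to each $i\in[\gamma']$ such that $f'_x(U'_i)+\delta(U'_i)\ge f_x(U'_i)$ for all $i=1,\ldots,\gamma'$ and all $x\in\mathcal{X}$. Then $$\mathrm{DF\text{-}MV}\le \mathrm{MV}'+\sum_{i=1}^{\gamma'}\delta(U'_i)\quad\text{and}\quad \mathrm{DF\text{-}MP}\le \mathrm{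MP}'+\frac{\sum_{i=1}^{\gamma'}\delta(U'_i)}{\sum_{i=1}^{\gamma'}|U'_i|}.$$
   Context: A set function $f:\mathcal{P}(A)\to\mathbb{R}$ is superadditive if $f(B\cup C)\ge f(B)+f(C)$ for all disjoint $B,C\subseteq A$. $\mathcal{P}(A)$ denotes the power set of $A$, and $[n]=\{1,\ldots,n\}$. *)

theory Defs
  imports "HOL-Probability.Probability"
begin

definition superadditive_on :: "'u set \<Rightarrow> ('u set \<Rightarrow> real) \<Rightarrow> bool" where
  "superadditive_on A f \<longleftrightarrow>
     (\<forall>B C. B \<subseteq> A \<longrightarrow> C \<subseteq> A \<longrightarrow> B \<inter> C = {} \<longrightarrow> f (B \<union> C) \<ge> f B + f C)"

definition distributions_on :: "'x set \<Rightarrow> 'x pmf set" where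
  "distributions_on X = {D. set_pmf D \<subseteq> X}"

(* A partition is a set of groups, so "min over i" is a minimum over the groups themselves.
   The maxima over distributions are written as suprema of reals; the lemmas DF_MV_attained and
   DF_MP_attained below show that for finite nonempty data they are indeed attained. *)

definition DF_MV :: "'x set \<Rightarrow> 'u set set \<Rightarrow> ('x \<Rightarrow> 'u set \<Rightarrow> real) \<Rightarrow> real" where
  "DF_MV X \<Gamma> f =
     (SUP D\<in>distributions_on X. MIN V\<in>\<Gamma>. measure_pmf.expectation D (\<lambda>x. f x V))"

definition DF_MP :: "'x set \<Rightarrow> 'u set set \<Rightarrow> ('x \<Rightarrow> 'u set \<Rightarrow> real) \<Rightarrow> real" where
  "DF_MP X \<Gamma> f =
     (SUP D\<in>distributions_on X.
        MIN V\<in>\<Gamma>. measure_pmf.expectation D (\<lambda>x. f x V / real (card V)))"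

definition MV :: "'x set \<Rightarrow> 'u set \<Rightarrow> ('x \<Rightarrow> 'u set \<Rightarrow> real) \<Rightarrow> real" where
  "MV X U f = (MAX x\<in>X. f x U)"

definition MP :: "'x set \<Rightarrow> 'u set \<Rightarrow> ('x \<Rightarrow> 'u set \<Rightarrow> real) \<Rightarrow> real" where
  "MP X U f = (MAX x\<in>X. f x U / real (card U))"

lemma continuous_on_MIN:
  fixes g :: "'i \<Rightarrow> 'a::topological_space \<Rightarrow> real"
  assumes "finite I" "I \<noteq> {}" "\<And>i. i \<in> I \<Longrightarrow> continuous_on S (g i)"
  shows "continuous_on S (\<lambda>p. MIN i\<in>I. g i p)"
  using assms
proof (induction I rule: finite_ne_induct)
  case (singleton i)
  then show ?case by simp
next
  case (insert i F)
  have "(\<lambda>p. MIN j\<in>insert i F. g j p) = (\<lambda>p. min (g i p) (MIN j\<in>F. g j p))"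
    using insert.hyps by auto
  then show ?case
    using insert by (auto intro!: continuous_on_min)
qed

lemma maxmin_expectation_attained:
  fixes g :: "'x \<Rightarrow> 'v \<Rightarrow> real"
  assumes X: "finite X" "X \<noteq> {}" and G: "finite \<Gamma>" "\<Gamma> \<noteq> {}"
  obtains D where "D \<in> distributions_on X"
    and "\<And>D'. D' \<in> distributions_on X \<Longrightarrow>
      (MIN V\<in>\<Gamma>. measure_pmf.expectation D' (\<lambda>x. g x V))
        \<le> (MIN V\<in>\<Gamma>. measure_pmf.expectation D (\<lambda>x. g x V))"
proof -
  define K :: "('x \<Rightarrow> real) set" where
    "K = PiE UNIV (\<lambda>x. if x \<in> X then {0..1} else {0}) \<inter> {p. (\<Sum>x\<in>X. p x) = 1}"
  define h where "h p = (MIN V\<in>\<Gamma>. \<Sum>x\<in>X. g x V * p x)" for p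
  have E: "(MIN V\<in>\<Gamma>. measure_pmf.expectation D (\<lambda>x. g x V)) = h (pmf D)"
    if "D \<in> distributions_on X" for D
  proof -
    have "measure_pmf.expectation D (\<lambda>x. g x V) = (\<Sum>x\<in>X. g x V * pmf D x)" for V
      by (rule integral_measure_pmf_real[OF X(1)]) (use that in \<open>auto simp: distributions_on_def\<close>)
    then show ?thesis by (simp only: h_def)
  qed
  have mem: "pmf D \<in> K" if "D \<in> distributions_on X" for D
    using that X(1) sum_pmf_eq_1[of X D]
    by (auto simp: K_def distributions_on_def pmf_le_1 pmf_eq_0_set_pmf)
  have "compactin (product_topology (\<lambda>_. euclidean) UNIV)
          (PiE UNIV (\<lambda>x. if x \<in> X then {0..1} else {0::real}))"
    by (subst compactin_PiE) auto
  then have "compact (PiE UNIV (\<lambda>x. if x \<in> X then {0..1} else {0::real}))"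
    by (simp add: euclidean_product_topology)
  moreover have "closed {p :: 'x \<Rightarrow> real. (\<Sum>x\<in>X. p x) = 1}"
    by (intro closed_Collect_eq continuous_intros) auto
  ultimately have "compact K"
    unfolding K_def by (rule compact_Int_closed)
  moreover have "K \<noteq> {}"
  proof -
    obtain x where "x \<in> X" using X by auto
    then have "return_pmf x \<in> distributions_on X" by (simp add: distributions_on_def)
    then show ?thesis using mem by blast
  qed
  moreover have "continuous_on K h"
    unfolding h_def
    by (intro continuous_on_MIN G continuous_on_sum continuous_on_mult continuous_on_const
          continuous_on_subset[OF continuous_on_product_coordinates subset_UNIV])
  ultimately obtain p where p: "p \<in> K" and max: "\<And>q. q \<in> K \<Longrightarrow> h q \<le> h p"
    using continuous_attains_sup[of K h] by blast
  have range: "p x \<in> (if x \<in> X then {0..1} else {0})" for x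
    using p unfolding K_def by (blast intro: PiE_mem)
  have nonneg: "0 \<le> p x" for x using range[of x] by (auto split: if_splits)
  have zero: "p x = 0" if "x \<notin> X" for x using range[of x] that by auto
  have "(\<integral>\<^sup>+x. ennreal (p x) \<partial>count_space UNIV) = (\<Sum>x\<in>X. ennreal (p x))"
    by (rule nn_integral_count_space') (use X zero in auto)
  also have "\<dots> = ennreal (\<Sum>x\<in>X. p x)" by (rule sum_ennreal) (simp add: nonneg)
  also have "\<dots> = 1" using p by (simp add: K_def)
  finally have one: "(\<integral>\<^sup>+x. ennreal (p x) \<partial>count_space UNIV) = 1" .
  define D where "D = embed_pmf p"
  have pmf_D: "pmf D = p"
    unfolding D_def by (rule ext) (rule pmf_embed_pmf[OF nonneg one])
  have D: "D \<in> distributions_on X"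
    using zero by (auto simp: distributions_on_def set_pmf_eq pmf_D)
  show ?thesis
  proof (rule that[OF D])
    fix D' assume D': "D' \<in> distributions_on X"
    show "(MIN V\<in>\<Gamma>. measure_pmf.expectation D' (\<lambda>x. g x V))
            \<le> (MIN V\<in>\<Gamma>. measure_pmf.expectation D (\<lambda>x. g x V))"
      unfolding E[OF D] E[OF D'] pmf_D by (rule max[OF mem[OF D']])
  qed
qed

lemma DF_MV_attained:
  assumes "finite X" "X \<noteq> {}" "finite \<Gamma>" "\<Gamma> \<noteq> {}"
  obtains D where "D \<in> distributions_on X"
    and "DF_MV X \<Gamma> f = (MIN V\<in>\<Gamma>. measure_pmf.expectation D (\<lambda>x. f x V))"
    and "\<And>D'. D' \<in> distributions_on X \<Longrightarrow>
      (MIN V\<in>\<Gamma>. measure_pmf.expectation D' (\<lambda>x. f x V)) \<le> DF_MV X \<Gamma> f"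
proof -
  obtain D where D: "D \<in> distributions_on X" and max: "\<And>D'. D' \<in> distributions_on X \<Longrightarrow>
      (MIN V\<in>\<Gamma>. measure_pmf.expectation D' (\<lambda>x. f x V))
        \<le> (MIN V\<in>\<Gamma>. measure_pmf.expectation D (\<lambda>x. f x V))"
    using maxmin_expectation_attained[OF assms, of f] by blast
  have "DF_MV X \<Gamma> f = (MIN V\<in>\<Gamma>. measure_pmf.expectation D (\<lambda>x. f x V))"
    unfolding DF_MV_def by (rule cSup_eq_maximum) (use D max in auto)
  with D max show ?thesis using that by simp
qed

lemma DF_MP_attained:
  assumes "finite X" "X \<noteq> {}" "finite \<Gamma>" "\<Gamma> \<noteq> {}"
  obtains D where "D \<in> distributions_on X"
    and "DF_MP X \<Gamma> f = (MIN V\<in>\<Gamma>. measure_pmf.expectation D (\<lambda>x. f x V / real (card V)))"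
    and "\<And>D'. D' \<in> distributions_on X \<Longrightarrow>
      (MIN V\<in>\<Gamma>. measure_pmf.expectation D' (\<lambda>x. f x V / real (card V))) \<le> DF_MP X \<Gamma> f"
proof -
  have eq: "DF_MP X \<Gamma> f = DF_MV X \<Gamma> (\<lambda>x V. f x V / real (card V))"
    by (simp only: DF_MP_def DF_MV_def)
  show ?thesis
    by (rule DF_MV_attained[OF assms, of "\<lambda>x V. f x V / real (card V)"])
       (rule that; simp only: eq)
qed

end

theory Submission
  imports Defs
begin

text \<open>
  Every distribution \<open>D\<close> satisfies
  \<open>\<Sum>V\<in>\<Gamma>'. E f(V) \<le> E (\<Sum>V\<in>\<Gamma>'. f'(V)) + \<Sum>\<delta> \<le> E f'(U') + \<Sum>\<delta>\<close>,
  and an expectation never exceeds the maximum over the decisions.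
  A minimum over the groups is at most any sum over \<open>\<Gamma>'\<close>, because all terms are nonnegative; the
  minimum of the ratios \<open>E f(V) / |V|\<close> is at most the mediant of those in \<open>\<Gamma>'\<close>, whose
  denominator is \<open>|U'|\<close>.
\<close>

text \<open>Superadditivity is applied to one block and the union of the others. The induction
  starts from a single block because superadditivity gives only \<open>f {}\<close> \<le> 0, so the
  empty sum 0 could exceed \<open>f {}\<close>.\<close>

lemma superadditive_on_sum_le_Union:
  assumes "superadditive_on A f" "finite P" "P \<noteq> {}" "disjoint P" "\<Union>P \<subseteq> A"
  shows "(\<Sum>V\<in>P. f V) \<le> f (\<Union>P)"
  using assms(2-)
proof (induction P rule: finite_ne_induct)
  case (singleton V)
  then show ?case by simp
next
  case (insert V P)
  have "V \<inter> \<Union>P = {}"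
    using insert.hyps insert.prems by (auto simp: disjoint_def)
  then have "f V + f (\<Union>P) \<le> f (V \<union> \<Union>P)"
    using assms(1) insert.prems unfolding superadditive_on_def by auto
  moreover have "(\<Sum>V\<in>P. f V) \<le> f (\<Union>P)"
    using insert.prems by (intro insert.IH) (auto simp: disjoint_def)
  ultimately show ?case
    using insert.hyps by simp
qed

text \<open>The bound holds for each decision separately, so averaging over any \<open>D\<close>
  preserves it. The bound \<open>M\<close> is left abstract so that both objectives can use the
  lemma.\<close>

lemma sum_expectation_le:
  fixes f f' :: "'x \<Rightarrow> 'u set \<Rightarrow> real"
  assumes X: "finite X" "D \<in> distributions_on X"
    and P: "partition_on A P" "finite P" "P \<noteq> {}"
    and superadd: "\<And>x. x \<in> X \<Longrightarrow> superadditive_on A (f' x)"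
    and \<delta>: "\<And>x V. x \<in> X \<Longrightarrow> V \<in> P \<Longrightarrow> f x V \<le> f' x V + \<delta> V"
    and M: "\<And>x. x \<in> X \<Longrightarrow> f' x A \<le> M"
  shows "(\<Sum>V\<in>P. measure_pmf.expectation D (\<lambda>x. f x V)) \<le> M + (\<Sum>V\<in>P. \<delta> V)"
proof -
  have D: "set_pmf D \<subseteq> X"
    using X by (simp add: distributions_on_def)
  have integrable: "integrable (measure_pmf D) g" for g :: "'x \<Rightarrow> real"
    using D X by (intro integrable_measure_pmf_finite) (rule finite_subset)
  have pointwise: "(\<Sum>V\<in>P. f x V) \<le> M + (\<Sum>V\<in>P. \<delta> V)" if x: "x \<in> X" for x
  proof -
    have "(\<Sum>V\<in>P. f x V) \<le> (\<Sum>V\<in>P. f' x V) + (\<Sum>V\<in>P. \<delta> V)"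
      unfolding sum.distrib[symmetric] by (intro sum_mono \<delta> x)
    also have "(\<Sum>V\<in>P. f' x V) \<le> f' x A"
      using superadditive_on_sum_le_Union[OF superadd[OF x] P(2,3)] P(1)
      by (simp add: partition_on_def)
    also have "f' x A \<le> M"
      by (rule M[OF x])
    finally show ?thesis by simp
  qed
  have "(\<Sum>V\<in>P. measure_pmf.expectation D (\<lambda>x. f x V))
      = measure_pmf.expectation D (\<lambda>x. \<Sum>V\<in>P. f x V)"
    by (simp add: Bochner_Integration.integral_sum integrable)
  \<comment> \<open>The pointwise bound is known only for decisions in \<open>X\<close>, but
    \<open>X\<close> carries all the mass of \<open>D\<close>, so it holds almost
    everywhere.\<close>
  also have "\<dots> \<le> measure_pmf.expectation D (\<lambda>_. M + (\<Sum>V\<in>P. \<delta> V))"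
    using D pointwise by (intro integral_mono_AE integrable) (auto simp: AE_measure_pmf_iff)
  finally show ?thesis by simp
qed

theorem theorem3p3:
  fixes X :: "'x set"
    and U U' :: "'u set"
    and \<Gamma> \<Gamma>' :: "'u set set"
    and f f' :: "'x \<Rightarrow> 'u set \<Rightarrow> real"
    and \<delta> :: "'u set \<Rightarrow> real"
  assumes "finite X" and "X \<noteq> {}"
    and "finite U" and "partition_on U \<Gamma>"
    and f_nonneg: "\<And>x B. x \<in> X \<Longrightarrow> B \<subseteq> U \<Longrightarrow> 0 \<le> f x B"
    and "partition_on U' \<Gamma>'" and "\<Gamma>' \<subseteq> \<Gamma>" and "\<Gamma>' \<noteq> {}"
    and f'_superadditive: "\<And>x. x \<in> X \<Longrightarrow> superadditive_on U' (f' x)"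
    and \<delta>: "\<And>x V. x \<in> X \<Longrightarrow> V \<in> \<Gamma>' \<Longrightarrow> f' x V + \<delta> V \<ge> f x V"
  shows "DF_MV X \<Gamma> f \<le> MV X U' f' + (\<Sum>V\<in>\<Gamma>'. \<delta> V) \<and>
         DF_MP X \<Gamma> f \<le> MP X U' f' + (\<Sum>V\<in>\<Gamma>'. \<delta> V) / (\<Sum>V\<in>\<Gamma>'. real (card V))"
proof -
  have fin: "finite \<Gamma>"
    using assms(3,4) by (rule finite_elements)
  have ne: "\<Gamma> \<noteq> {}" and fin': "finite \<Gamma>'"
    using fin \<open>\<Gamma>' \<subseteq> \<Gamma>\<close> \<open>\<Gamma>' \<noteq> {}\<close> by (auto intro: finite_subset)
  have sub: "V \<subseteq> U" and V_ne: "V \<noteq> {}" if "V \<in> \<Gamma>'" for V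
    using that \<open>\<Gamma>' \<subseteq> \<Gamma>\<close> \<open>partition_on U \<Gamma>\<close> by (auto simp: partition_on_def)
  have finV: "finite V" if "V \<in> \<Gamma>'" for V
    using sub[OF that] \<open>finite U\<close> by (rule finite_subset)
  have card_pos: "0 < card V" if "V \<in> \<Gamma>'" for V
    using finV[OF that] V_ne[OF that] by (simp add: card_gt_0_iff)
  \<comment> \<open>The blocks are finite and disjoint, so the denominator in \<open>MP\<close>
    agrees with the one in the claim.\<close>
  have "card U' = (\<Sum>V\<in>\<Gamma>'. card V)"
    using \<open>partition_on U' \<Gamma>'\<close> finV
    by (metis card_Union_disjoint partition_onD1 partition_onD2 disjoint_def pairwise_def disjnt_def)
  then have card: "real (card U') = (\<Sum>V\<in>\<Gamma>'. real (card V))"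
    by simp
  have card_U': "0 < real (card U')"
    unfolding card using fin' \<open>\<Gamma>' \<noteq> {}\<close> card_pos by (intro sum_pos) auto
  note bound = sum_expectation_le[OF \<open>finite X\<close> _ \<open>partition_on U' \<Gamma>'\<close> fin' \<open>\<Gamma>' \<noteq> {}\<close>
      f'_superadditive \<delta>]

  obtain D where D: "D \<in> distributions_on X"
    and opt: "DF_MV X \<Gamma> f = (MIN V\<in>\<Gamma>. measure_pmf.expectation D (\<lambda>x. f x V))"
    using DF_MV_attained[OF assms(1,2) fin ne] by blast
  obtain W where W: "W \<in> \<Gamma>'"
    using \<open>\<Gamma>' \<noteq> {}\<close> by blast
  have "DF_MV X \<Gamma> f \<le> measure_pmf.expectation D (\<lambda>x. f x W)"
    unfolding opt using fin W \<open>\<Gamma>' \<subseteq> \<Gamma>\<close> by (intro Min_le) auto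
  \<comment> \<open>The terms added to the one for \<open>W\<close> are nonnegative: each block lies
    in \<open>U\<close>, and \<open>D\<close> is supported on \<open>X\<close>.\<close>
  also have "\<dots> \<le> (\<Sum>V\<in>\<Gamma>'. measure_pmf.expectation D (\<lambda>x. f x V))"
    using D sub fin' W
    by (intro member_le_sum integral_nonneg_AE)
       (auto simp: AE_measure_pmf_iff distributions_on_def intro!: f_nonneg)
  also have "\<dots> \<le> MV X U' f' + (\<Sum>V\<in>\<Gamma>'. \<delta> V)"
    by (rule bound[OF D]) (use \<open>finite X\<close> in \<open>auto simp: MV_def\<close>)
  finally have MV: "DF_MV X \<Gamma> f \<le> MV X U' f' + (\<Sum>V\<in>\<Gamma>'. \<delta> V)" .

  obtain E where E: "E \<in> distributions_on X"
    and opt: "DF_MP X \<Gamma> f = (MIN V\<in>\<Gamma>. measure_pmf.expectation E (\<lambda>x. f x V / real (card V)))"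
    using DF_MP_attained[OF assms(1,2) fin ne] by blast
  \<comment> \<open>With denominators cleared, these inequalities can be summed over
    \<open>\<Gamma>'\<close>; the weights \<open>card V\<close> then add up to
    \<open>card U'\<close>.\<close>
  have "DF_MP X \<Gamma> f * real (card V) \<le> measure_pmf.expectation E (\<lambda>x. f x V)"
    if V: "V \<in> \<Gamma>'" for V
  proof -
    have "DF_MP X \<Gamma> f \<le> measure_pmf.expectation E (\<lambda>x. f x V / real (card V))"
      unfolding opt using fin V \<open>\<Gamma>' \<subseteq> \<Gamma>\<close> by (intro Min_le) auto
    then show ?thesis
      using card_pos[OF V] by (simp add: field_simps)
  qed
  then have "DF_MP X \<Gamma> f * real (card U') \<le> (\<Sum>V\<in>\<Gamma>'. measure_pmf.expectation E (\<lambda>x. f x V))"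
    unfolding card sum_distrib_left by (rule sum_mono)
  also have "\<dots> \<le> MP X U' f' * real (card U') + (\<Sum>V\<in>\<Gamma>'. \<delta> V)"
  \<comment> \<open>Here \<open>M\<close> is \<open>MP X U' f' * real (card U')\<close>; dividing by
    the positive \<open>card U'\<close> afterwards recovers the ratio.\<close>
  proof (rule bound[OF E])
    fix x assume "x \<in> X"
    then have "f' x U' / real (card U') \<le> MP X U' f'"
      unfolding MP_def using \<open>finite X\<close> by (intro Max_ge) auto
    then show "f' x U' \<le> MP X U' f' * real (card U')"
      using card_U' by (simp add: field_simps)
  qed
  finally have "DF_MP X \<Gamma> f \<le> MP X U' f' + (\<Sum>V\<in>\<Gamma>'. \<delta> V) / real (card U')"
    using card_U' by (simp add: field_simps)
  with MV show ?thesis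
    unfolding card by blast
qed

end
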